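(* Let $A\subseteq\mathrm{Ref}(n)$ be an antichain. Then in the partition lattice $\Pi_n$ we have $\textsc{fi}(A)^*=\textsc{fi}(B)$, where $$B=\min_{\mathrm{Ref}(n)}\Big(\mathfrak P_n\setminus \bigcup_{\lambda\in A}\mathrm{Dom}(n)_{\le\lambda'}\Big),$$ i.e. $B$ is the set of refinement-minimal number partitions of $n$ among those that are not dominated by $\lambda'$ for any $\lambda\in A$.
   Context: $\Pi_n$ is the lattice of set partitions of $[n]=\{1,\dots,n\}$ ordered by refinement ($\sigma\le\tau$ if every block of $\sigma$ is contained in a block of $\tau$); its bottom $\hat 0$ is the partition into singletons. $\mathfrak P_n$ is the set of partitions of the integer $n$, written with parts in decreasing order. For $\lambda=(\lambda_1,\lambda_2,\dots),\mu=(\mu_1,\mu_2,\dots)\in\mathfrak P_n$: in the dominance order $\mathrm{Dom}(n)$, $\lambda\le\mu$ if $\sum_{i\le k}\lambda_i\le\sum_{j\le k}\mu_j$ for all $k$; in the refinement order $\mathrm{Ref}(n)$, $\lambda\le\mu$ if $\lambda$ can be obtained from $\mu$ by partitioning its parts. $\mathrm{Dom}(n)_{\le x}=\{y: y\le x \text{ in }\mathrm{Dom}(n)\}$, $\lambda'$ is the transpose (conjugate) partition, and $\min_{\mathrm{Ref}(n)}E$ is the set of minimal elements of $E$ in $\mathrm{Ref}(n)$. The shape map $\textsc{sh}:\Pi_n\to\mathfrak P_n$ sends a set partition to the multiset of its block sizes, and $\textsc{fi}(S)=\textsc{sh}^{-1}(S)$ for $S\subseteq\mathfrak P_n$. In a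 finite bounded poset $P$ (bottom $\hat 0$, top $\hat1$), an antichain is a nonempty set $A$ with $\hat 0\notin A$ of pairwise incomparable elements; $\Lambda(x)$ denotes the set of atoms below $x$; the blocker of an antichain $A$ is $A^*=\min\{x\in P:\Lambda(x)\cap\Lambda(a)\neq\emptyset\ \forall a\in A\}$ ($\min$ = set of minimal elements). In particular an antichain in $\mathrm{Ref}(n)$ does not contain its bottom element $(1^n)$. *)

theory Defs
  imports "HOL-Library.Multiset" "HOL-Library.Disjoint_Sets"
begin

text \<open>A poset is given by its carrier \<open>P\<close> and its order relation \<open>le\<close>, which is only
  ever evaluated on elements of \<open>P\<close>.\<close>

definition is_bottom :: "'a set \<Rightarrow> ('a \<Rightarrow> 'a \<Rightarrow> bool) \<Rightarrow> 'a \<Rightarrow> bool" where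
  "is_bottom P le b \<longleftrightarrow> b \<in> P \<and> (\<forall>x\<in>P. le b x)"

definition minimal_elems :: "('a \<Rightarrow> 'a \<Rightarrow> bool) \<Rightarrow> 'a set \<Rightarrow> 'a set" where
  "minimal_elems le E = {x \<in> E. \<forall>y\<in>E. le y x \<longrightarrow> y = x}"

definition down_set :: "'a set \<Rightarrow> ('a \<Rightarrow> 'a \<Rightarrow> bool) \<Rightarrow> 'a \<Rightarrow> 'a set" where
  "down_set P le x = {y \<in> P. le y x}"

definition antichain :: "'a set \<Rightarrow> ('a \<Rightarrow> 'a \<Rightarrow> bool) \<Rightarrow> 'a set \<Rightarrow> bool" where
  "antichain P le A \<longleftrightarrow> A \<subseteq> P \<and> A \<noteq> {} \<and> (\<forall>a\<in>A. \<not> is_bottom P le a) \<and>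
     (\<forall>a\<in>A. \<forall>b\<in>A. a \<noteq> b \<longrightarrow> \<not> le a b \<and> \<not> le b a)"

definition is_atom :: "'a set \<Rightarrow> ('a \<Rightarrow> 'a \<Rightarrow> bool) \<Rightarrow> 'a \<Rightarrow> bool" where
  "is_atom P le a \<longleftrightarrow> a \<in> P \<and> \<not> is_bottom P le a \<and>
     (\<forall>x\<in>P. le x a \<longrightarrow> x = a \<or> is_bottom P le x)"

definition atoms_below :: "'a set \<Rightarrow> ('a \<Rightarrow> 'a \<Rightarrow> bool) \<Rightarrow> 'a \<Rightarrow> 'a set" where
  "atoms_below P le x = {a. is_atom P le a \<and> le a x}"

definition blocker :: "'a set \<Rightarrow> ('a \<Rightarrow> 'a \<Rightarrow> bool) \<Rightarrow> 'a set \<Rightarrow> 'a set" where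
  "blocker P le A =
     minimal_elems le {x \<in> P. \<forall>a\<in>A. atoms_below P le x \<inter> atoms_below P le a \<noteq> {}}"

definition set_parts :: "nat \<Rightarrow> nat set set set" where
  "set_parts n = {\<pi>. partition_on {1..n} \<pi>}"

text \<open>A partition of the integer \<open>n\<close> is the multiset of its (positive) parts; \<open>parts_desc\<close>
  recovers the weakly decreasing sequence of parts.\<close>

definition int_parts :: "nat \<Rightarrow> nat multiset set" where
  "int_parts n = {p. 0 \<notin># p \<and> sum_mset p = n}"

definition parts_desc :: "nat multiset \<Rightarrow> nat list" where
  "parts_desc p = rev (sorted_list_of_multiset p)"

definition dom_le :: "nat multiset \<Rightarrow> nat multiset \<Rightarrow> bool" where
  "dom_le p q \<longleftrightarrow>
     (\<forall>k. sum_list (take k (parts_desc p)) \<le> sum_list (take k (parts_desc q)))"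

text \<open>\<open>N\<close> collects, for every part of \<open>q\<close> (with multiplicity), the multiset of summands
  into which this part is split; \<open>p\<close> is the multiset of all these summands.\<close>

definition ref_le :: "nat multiset \<Rightarrow> nat multiset \<Rightarrow> bool" where
  "ref_le p q \<longleftrightarrow>
     (\<exists>N :: nat multiset multiset. image_mset sum_mset N = q \<and> sum_mset N = p)"

text \<open>The \<open>j\<close>-th part of the transpose is the number of parts that are at least \<open>j\<close>;
  \<open>j\<close> ranges over the indices for which this number is positive.\<close>

definition transpose_part :: "nat multiset \<Rightarrow> nat multiset" where
  "transpose_part p =
     {# size {# x \<in># p. j \<le> x #}. j \<in># mset_set {j. 1 \<le> j \<and> (\<exists>x\<in>#p. j \<le> x)} #}"

definition shape :: "nat set set \<Rightarrow> nat multiset" where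
  "shape \<pi> = image_mset card (mset_set \<pi>)"

definition fiber :: "nat \<Rightarrow> nat multiset set \<Rightarrow> nat set set set" where
  "fiber n S = {\<pi> \<in> set_parts n. shape \<pi> \<in> S}"

end

theory Submission
  imports Defs
begin

text \<open>Two set partitions have a common atom below them iff some two points lie in a common block of
  both. By the Gale--Ryser theorem, a set partition \<open>\<pi>\<close> shares no pair with some partition of
  shape \<open>\<lambda>\<close> iff the shape of \<open>\<pi>\<close> is dominated by \<open>\<lambda>'\<close>. So the set whose minimal
  elements form the blocker is the fiber of the number partitions not dominated by any \<open>\<lambda>'\<close>.
  Taking minimal elements commutes with taking fibers: refinements of shapes lift to refinements of
  set partitions, and a proper refinement strictly increases the number of blocks.\<close>

section \<open>Shapes and refinement\<close>

lemma shape_empty [simp]: "shape {} = {#}"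
  by (simp add: shape_def)

lemma shape_insert: "finite P \<Longrightarrow> C \<notin> P \<Longrightarrow> shape (insert C P) = add_mset (card C) (shape P)"
  by (simp add: shape_def)

text \<open>Written as a sum over blocks, a shape splits along disjoint groups of blocks by
  \<open>sum.UNION_disjoint\<close>.\<close>

lemma shape_eq_sum: "shape P = (\<Sum>B\<in>P. {#card B#})"
  unfolding shape_def sum_unfold_sum_mset by (induction "mset_set P") auto

lemma sum_mset_shape: "sum_mset (shape P) = (\<Sum>B\<in>P. card B)"
  by (simp add: shape_def sum_unfold_sum_mset)

lemma size_shape: "size (shape P) = card P"
  by (simp add: shape_def)

lemma sum_mset_shape_partition:
  assumes "finite X" "partition_on X P"
  shows "sum_mset (shape P) = card X"
proof -
  have "finite B" if "B \<in> P" for B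
    using assms that by (metis Sup_upper finite_subset partition_onD1)
  then show ?thesis
    using product_partition[OF assms(2)] by (simp add: sum_mset_shape)
qed

lemma zero_notin_shape:
  assumes "finite X" "partition_on X P"
  shows "0 \<notin># shape P"
proof -
  have "finite B \<and> B \<noteq> {}" if "B \<in> P" for B
    using assms that by (metis Sup_upper finite_subset partition_onD1 partition_onD3)
  then show ?thesis
    using finite_elements[OF assms] by (auto simp: shape_def)
qed

lemma shape_in_int_parts: "\<pi> \<in> set_parts n \<Longrightarrow> shape \<pi> \<in> int_parts n"
  using sum_mset_shape_partition[of "{1..n}" \<pi>] zero_notin_shape[of "{1..n}" \<pi>]
  by (simp add: set_parts_def int_parts_def)

text \<open>The blocks of \<pi> inside a block \<open>B\<close> of \<sigma> form a partition of
  \<open>B\<close>. The shapes of these partitions, one for each \<open>B\<close>, are the witness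
  \<open>N\<close> required by \<open>ref_le\<close>.\<close>

lemma ref_le_shape:
  assumes "finite X" "refines X \<pi> \<sigma>"
  shows "ref_le (shape \<pi>) (shape \<sigma>)"
proof -
  have P: "partition_on X \<pi>" "partition_on X \<sigma>" using assms(2) by (auto simp: refines_def)
  have fin: "finite \<pi>" "finite \<sigma>" using P finite_elements[OF assms(1)] by auto
  let ?h = "\<lambda>B. {b \<in> \<pi>. b \<subseteq> B}"
  have part: "partition_on B (?h B)" if "B \<in> \<sigma>" for B
    using refines_obtains_subset[OF assms(2) that] .
  have finB: "finite B" if "B \<in> \<sigma>" for B
    using assms(1) P(2) that by (metis Sup_upper finite_subset partition_onD1)
  let ?N = "image_mset (\<lambda>B. shape (?h B)) (mset_set \<sigma>)"
  have "image_mset sum_mset ?N = shape \<sigma>"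
    unfolding shape_def[of \<sigma>] multiset.map_comp comp_def
    by (rule image_mset_cong) (use sum_mset_shape_partition part finB fin in auto)
  moreover have "sum_mset ?N = shape \<pi>"
  proof -
    have un: "\<pi> = (\<Union>B\<in>\<sigma>. ?h B)" using assms(2) by (auto simp: refines_def)
    have disj: "?h B \<inter> ?h C = {}" if "B \<in> \<sigma>" "C \<in> \<sigma>" "B \<noteq> C" for B C
    proof -
      have "B \<inter> C = {}" using disjointD[OF partition_onD2[OF P(2)] that] .
      then have "b = {}" if "b \<subseteq> B" "b \<subseteq> C" for b using that by blast
      then show ?thesis using partition_onD3[OF P(1)] by auto
    qed
    have "sum_mset ?N = (\<Sum>B\<in>\<sigma>. shape (?h B))" by (simp add: sum_unfold_sum_mset)
    also have "\<dots> = (\<Sum>b\<in>(\<Union>B\<in>\<sigma>. ?h B). {#card b#})"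
      unfolding shape_eq_sum by (rule sum.UNION_disjoint[symmetric]) (use fin disj in auto)
    also have "\<dots> = shape \<pi>" using un shape_eq_sum by metis
    finally show ?thesis .
  qed
  ultimately show ?thesis unfolding ref_le_def by blast
qed

text \<open>Sending each block of \<pi> to the block of \<sigma> around it is surjective, hence
  injective when the cardinalities agree. A block of \<sigma> then contains only one block of \<pi>
  and is equal to it.\<close>

lemma refines_eq_of_card_eq:
  assumes "finite X" "refines X \<pi> \<sigma>" "card \<pi> = card \<sigma>"
  shows "\<pi> = \<sigma>"
proof -
  have P: "partition_on X \<pi>" "partition_on X \<sigma>" using assms(2) by (auto simp: refines_def)
  have fin: "finite \<pi>" using P finite_elements[OF assms(1)] by auto
  obtain f where f: "\<And>b. b \<in> \<pi> \<Longrightarrow> f b \<in> \<sigma> \<and> b \<subseteq> f b"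
    using assms(2) unfolding refines_def by metis
  have block: "\<exists>b\<in>\<pi>. x \<in> b \<and> f b = B" if "B \<in> \<sigma>" "x \<in> B" for B x
  proof -
    have "x \<in> \<Union>\<pi>" using that partition_onD1[OF P(1)] partition_onD1[OF P(2)] by blast
    then obtain b where b: "b \<in> \<pi>" "x \<in> b" by (rule UnionE)
    have "f b = B"
    proof (rule ccontr)
      assume "f b \<noteq> B"
      with that f[OF b(1)] have "f b \<inter> B = {}" by (intro disjointD[OF partition_onD2[OF P(2)]]) auto
      with that f[OF b(1)] b show False by blast
    qed
    with b show ?thesis by blast
  qed
  have "f ` \<pi> = \<sigma>"
  proof
    show "f ` \<pi> \<subseteq> \<sigma>" using f by blast
    show "\<sigma> \<subseteq> f ` \<pi>"
    proof
      fix B assume "B \<in> \<sigma>"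
      moreover then obtain x where "x \<in> B" using P(2) by (metis all_not_in_conv partition_onD3)
      ultimately show "B \<in> f ` \<pi>" using block by blast
    qed
  qed
  then have inj: "inj_on f \<pi>" using fin assms(3) by (simp add: eq_card_imp_inj_on)
  have "f b \<subseteq> b" if "b \<in> \<pi>" for b
  proof
    fix x assume "x \<in> f b"
    with block[of "f b" x] f[OF that] obtain b' where "b' \<in> \<pi>" "x \<in> b'" "f b' = f b" by blast
    then show "x \<in> b" using inj_onD[OF inj, of b' b] that by simp
  qed
  then have "\<forall>B\<in>\<sigma>. \<exists>b\<in>\<pi>. B \<subseteq> b" using \<open>f ` \<pi> = \<sigma>\<close> by auto
  then have "refines X \<sigma> \<pi>" using P by (simp add: refines_def)
  with assms(2) show ?thesis by (rule refines_asym)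
qed

section \<open>Constructing set partitions of a given shape\<close>

lemma partition_insert:
  assumes "partition_on (X - C) P" "C \<subseteq> X" "C \<noteq> {}"
  shows "partition_on X (insert C P)" "C \<notin> P"
proof -
  have "disjnt C (\<Union>P)" using partition_onD1[OF assms(1)] by (auto simp: disjnt_iff)
  then show "partition_on X (insert C P)" "C \<notin> P"
    using assms by (auto simp: partition_on_insert disjnt_iff)
qed

lemma partition_of_shape_exists:
  assumes "finite X" "card X = sum_mset q" "0 \<notin># q"
  shows "\<exists>P. partition_on X P \<and> shape P = q"
  using assms
proof (induction q arbitrary: X)
  case empty
  then show ?case by (auto simp: partition_on_empty intro!: exI[of _ "{}"])
next
  case (add c q)
  obtain C where C: "C \<subseteq> X" "card C = c" "finite C"
    by (rule obtain_subset_with_card_n[of c X]) (use add.prems in auto)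
  have "card (X - C) = sum_mset q" using C add.prems by (simp add: card_Diff_subset)
  then obtain P where P: "partition_on (X - C) P" "shape P = q"
    using add.IH[of "X - C"] add.prems by auto
  have "C \<noteq> {}" using C add.prems by auto
  note ins = partition_insert[OF P(1) C(1) this]
  have "finite P" using P(1) add.prems(1) finite_elements by blast
  then show ?case using ins P(2) C(2) shape_insert by blast
qed

text \<open>A converse to \<open>ref_le_shape\<close>, by induction on the witness \<open>N\<close>
  of \<open>ref_le\<close>: an element \<open>M\<close> of \<open>N\<close> prescribes how to cut up
  one block of size \<open>sum_mset M\<close>, and the induction hypothesis treats the other
  blocks.\<close>

lemma refinement_of_shape_exists:
  assumes "finite X" "partition_on X \<sigma>" "ref_le q (shape \<sigma>)" "0 \<notin># q"
  shows "\<exists>\<pi>. refines X \<pi> \<sigma> \<and> shape \<pi> = q"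
proof -
  obtain N where "image_mset sum_mset N = shape \<sigma>" "sum_mset N = q"
    using assms(3) unfolding ref_le_def by blast
  then show ?thesis using assms(1,2,4)
  proof (induction N arbitrary: X \<sigma> q)
    case empty
    then have "\<sigma> = {}" "q = {#}"
      using size_shape[of \<sigma>] finite_elements[of X \<sigma>] by auto
    with empty show ?case using refines_refl by (intro exI[of _ "{}"]) auto
  next
    case (add M N)
    have fs: "finite \<sigma>" using add.prems finite_elements by blast
    obtain B where B: "B \<in> \<sigma>" "card B = sum_mset M"
    proof -
      have "sum_mset M \<in># shape \<sigma>" using add.prems(1) by (metis image_mset_add_mset union_single_eq_member)
      then show ?thesis using that fs by (auto simp: shape_def)
    qed
    have sB: "insert B (\<sigma> - {B}) = \<sigma>" using B by blast
    have BX: "B \<subseteq> X" "B \<noteq> {}" using add.prems B by (auto simp: partition_on_def)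
    have "disjnt B (\<Union>(\<sigma> - {B}))" using add.prems(4) B
      by (auto simp: partition_on_def disjoint_def disjnt_def)
    then have p: "partition_on (X - B) (\<sigma> - {B})" using add.prems(4) sB partition_on_insert by metis
    have "shape \<sigma> = add_mset (card B) (shape (\<sigma> - {B}))"
      using shape_insert[of "\<sigma> - {B}" B] fs sB by simp
    then have "image_mset sum_mset N = shape (\<sigma> - {B})" using add.prems(1) B by simp
    then obtain \<pi> where \<pi>: "refines (X - B) \<pi> (\<sigma> - {B})" "shape \<pi> = sum_mset N"
      using add.IH[OF _ refl _ p] add.prems by auto
    obtain P where P: "partition_on B P" "shape P = M"
    proof -
      have "finite B" using BX(1) add.prems(3) by (rule finite_subset)
      then show ?thesis using partition_of_shape_exists[of B M] B add.prems(2,5) that by auto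
    qed
    have pi: "partition_on (X - B) \<pi>" using \<pi>(1) by (simp add: refines_def)
    \<comment> \<open>Blocks are nonempty, so disjoint supports exclude a common block; this makes
      the shape of \<open>P \<union> \<pi>\<close> the sum of the two shapes.\<close>
    have disj: "\<Union>P \<inter> \<Union>\<pi> = {}" using partition_onD1[OF P(1)] partition_onD1[OF pi] by blast
    then have disj': "P \<inter> \<pi> = {}" using partition_onD3[OF P(1)] 
      by (metis Sup_upper disjoint_iff le_inf_iff subset_empty)
    have "partition_on X (P \<union> \<pi>)"
      using P(1) pi BX disj disjoint_union[of P \<pi>] by (auto simp: partition_on_def)
    moreover have "\<forall>b\<in>P \<union> \<pi>. \<exists>C\<in>\<sigma>. b \<subseteq> C"
      using \<pi>(1) B partition_onD1[OF P(1)] by (auto simp: refines_def)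
    ultimately have "refines X (P \<union> \<pi>) \<sigma>" using add.prems(4) by (simp add: refines_def)
    moreover have "shape (P \<union> \<pi>) = q"
    proof -
      have "finite P" "finite \<pi>"
        using P(1) pi BX add.prems(3) finite_elements finite_subset by blast+
      then have "shape (P \<union> \<pi>) = shape P + shape \<pi>"
        using disj' by (simp add: shape_def mset_set_Union)
      then show ?thesis using P \<pi> add.prems by simp
    qed
    ultimately show ?case by blast
  qed
qed

text \<open>One inclusion lifts a smaller shape in \<open>U\<close> to a refinement of \<pi>. For
  the other, minimality of the shape forces a refinement in the fiber to have the same shape, so as
  many blocks as \<pi>.\<close>

lemma minimal_elems_fiber:
  assumes "U \<subseteq> int_parts n"
  shows "minimal_elems (refines {1..n}) (fiber n U) = fiber n (minimal_elems ref_le U)"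
proof (intro equalityI subsetI)
  fix \<pi> assume "\<pi> \<in> minimal_elems (refines {1..n}) (fiber n U)"
  then have \<pi>: "\<pi> \<in> set_parts n" "shape \<pi> \<in> U"
    and min: "\<And>\<rho>. \<rho> \<in> fiber n U \<Longrightarrow> refines {1..n} \<rho> \<pi> \<Longrightarrow> \<rho> = \<pi>"
    by (auto simp: minimal_elems_def fiber_def)
  have "q = shape \<pi>" if q: "q \<in> U" "ref_le q (shape \<pi>)" for q
  proof -
    have "0 \<notin># q" using q(1) assms by (auto simp: int_parts_def)
    then obtain \<rho> where \<rho>: "refines {1..n} \<rho> \<pi>" "shape \<rho> = q"
      using refinement_of_shape_exists[of "{1..n}" \<pi> q] \<pi>(1) q(2) by (auto simp: set_parts_def)
    then have "\<rho> \<in> fiber n U" using q by (auto simp: fiber_def set_parts_def refines_def)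
    with min \<rho> show ?thesis by blast
  qed
  with \<pi> show "\<pi> \<in> fiber n (minimal_elems ref_le U)" by (auto simp: fiber_def minimal_elems_def)
next
  fix \<pi> assume "\<pi> \<in> fiber n (minimal_elems ref_le U)"
  then have \<pi>: "\<pi> \<in> set_parts n" "shape \<pi> \<in> U"
    and min: "\<And>q. q \<in> U \<Longrightarrow> ref_le q (shape \<pi>) \<Longrightarrow> q = shape \<pi>"
    by (auto simp: minimal_elems_def fiber_def)
  have "\<rho> = \<pi>" if "\<rho> \<in> fiber n U" "refines {1..n} \<rho> \<pi>" for \<rho>
  proof (rule refines_eq_of_card_eq[OF _ that(2)])
    show "card \<rho> = card \<pi>"
      using min[of "shape \<rho>"] ref_le_shape[OF _ that(2)] that(1) size_shape
      by (metis (no_types, lifting) fiber_def finite_atLeastAtMost mem_Collect_eq)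
  qed simp
  with \<pi> show "\<pi> \<in> minimal_elems (refines {1..n}) (fiber n U)" by (auto simp: fiber_def minimal_elems_def)
qed

section \<open>Transversal partitions\<close>

lemma top_subset_exists:
  fixes m :: "'a \<Rightarrow> nat"
  assumes "finite J" "c \<le> card J"
  shows "\<exists>T\<subseteq>J. card T = c \<and> (\<forall>x\<in>T. \<forall>y\<in>J - T. m y \<le> m x)"
  using assms(2)
proof (induction c)
  case 0
  then show ?case by (intro exI[of _ "{}"]) auto
next
  case (Suc c)
  then obtain T where T: "T \<subseteq> J" "card T = c" "\<forall>x\<in>T. \<forall>y\<in>J - T. m y \<le> m x" by auto
  have "finite T" using T assms finite_subset by blast
  have "J - T \<noteq> {}" using T Suc.prems by auto
  then have "Max (m ` (J - T)) \<in> m ` (J - T)" using assms by (intro Max_in) auto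
  then obtain z where z: "z \<in> J - T" "m z = Max (m ` (J - T))" by auto
  then have "\<forall>y\<in>J - T. m y \<le> m z" using assms by auto
  with T z \<open>finite T\<close> show ?case by (intro exI[of _ "insert z T"]) auto
qed

text \<open>The increments of \<open>k\<close> \<mapsto> \<open>\<Sum>c\<in>#q. min c k\<close> are
  the column lengths of the Ferrers diagram of \<open>q\<close>. This gives both its concavity and
  its link to the transpose.\<close>

lemma sum_mset_min_Suc:
  "(\<Sum>c\<in>#q. min c (Suc k)) = (\<Sum>c\<in>#q. min c k) + size {#c \<in># q. Suc k \<le> c#}"
  by (induction q) auto

lemma size_filter_ge_antimono:
  fixes q :: "'a::order multiset"
  assumes "i \<le> j"
  shows "size {#x \<in># q. j \<le> x#} \<le> size {#x \<in># q. i \<le> x#}"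
  using assms by (induction q) (auto intro: order_trans le_SucI)

text \<open>The increments decrease weakly. If they add up to less than \<open>(k - s) * t\<close>
  between \<open>s\<close> and \<open>k\<close>, the last of them is below \<open>t\<close>, and so
  are all later ones.\<close>

lemma sum_mset_min_concave:
  fixes q :: "nat multiset"
  assumes "s \<le> k" "(\<Sum>c\<in>#q. min c k) < (\<Sum>c\<in>#q. min c s) + (k - s) * t"
  shows "(\<Sum>c\<in>#q. min c (k + j)) \<le> (\<Sum>c\<in>#q. min c k) + j * (t - 1)"
proof -
  define d where "d i = size {#c \<in># q. Suc i \<le> c#}" for i
  have mono: "d i' \<le> d i" if "i \<le> i'" for i i'
    unfolding d_def using that by (intro size_filter_ge_antimono) simp
  \<comment> \<open>For positive \<open>i\<close>, \<open>d (s + i - 1)\<close> is the last, hence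
    smallest, of the \<open>i\<close> increments from \<open>s\<close> to
    \<open>s + i\<close>.\<close>
  have lower: "(\<Sum>c\<in>#q. min c (s + i)) \<ge> (\<Sum>c\<in>#q. min c s) + i * t" if "t \<le> d (s + i - 1)" for i
    using that
  proof (induction i)
    case (Suc i)
    have "t \<le> d (s + i - 1)" using Suc.prems mono[of "s + i - 1" "s + i"] by simp
    with Suc show ?case using sum_mset_min_Suc[of "s + i" q] by (simp add: d_def)
  qed simp
  have "d (k - 1) \<le> t - 1" "k \<noteq> s"
    using lower[of "k - s"] assms by (force, auto)
  show ?thesis
  proof (induction j)
    case (Suc j)
    have "d (k + j) \<le> t - 1" using mono[of "k - 1" "k + j"] \<open>d (k - 1) \<le> t - 1\<close> by linarith
    with Suc show ?case using sum_mset_min_Suc[of "k + j" q] by (simp add: d_def)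
  qed simp
qed

text \<open>One step of the greedy construction: a part \<open>c\<close> uses up one element of each colour in \<open>T\<close>,
  the \<open>c\<close> most frequent colours. If the bound failed for \<open>S\<close>, then interpolating, in the
  integer-concave right-hand side, between \<open>S \<inter> T\<close> and \<open>S \<union> T\<close> would violate the bound for \<open>S \<union> T\<close>.\<close>

lemma remove_top_counts:
  fixes m :: "'a \<Rightarrow> nat" and q :: "nat multiset"
  assumes bound: "\<And>S. finite S \<Longrightarrow> (\<Sum>i\<in>S. m i) \<le> (\<Sum>d\<in>#add_mset c q. min d (card S))"
    and T: "finite T" "card T = c" "\<And>i. i \<in> T \<Longrightarrow> t \<le> m i" "\<And>i. i \<notin> T \<Longrightarrow> m i \<le> t"
    and S: "finite S"
  shows "(\<Sum>i\<in>S. m i) \<le> (\<Sum>d\<in>#q. min d (card S)) + card (S \<inter> T)"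
proof (rule ccontr)
  define F where "F k = (\<Sum>d\<in>#q. min d k)" for k
  define g where "g S = (\<Sum>i\<in>S. m i)" for S
  define k s where "k = card S" and "s = card (S \<inter> T)"
  assume "\<not> ?thesis"
  then have neg: "F k + s < g S" by (simp add: F_def g_def k_def s_def)
  have B: "g S' \<le> min c (card S') + F (card S')" if "finite S'" for S'
    using bound[OF that] by (simp add: F_def g_def)
  have s: "s \<le> k" "s \<le> c"
    unfolding s_def k_def using S T card_mono[of S "S \<inter> T"] card_mono[of T "S \<inter> T"] by auto
  have cST: "card (S - T) = k - s" unfolding k_def s_def using S by (simp add: card_Diff_subset_Int)
  have cTS: "card (T - S) = c - s"
    unfolding s_def using T by (simp add: card_Diff_subset_Int Int_commute)
  have "g S = g (S \<inter> T) + g (S - T)"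
    unfolding g_def using S by (metis sum.Int_Diff)
  also have "g (S - T) \<le> (k - s) * t"
    unfolding g_def using sum_bounded_above[of "S - T" m t] T(4) cST by simp
  finally have 1: "g S \<le> g (S \<inter> T) + (k - s) * t" by simp
  have "g (S \<inter> T) \<le> s + F s" using B[of "S \<inter> T"] S s by (simp add: s_def)
  \<comment> \<open>So \<open>F\<close> grows from \<open>s\<close> to \<open>k\<close> by less than
    \<open>t\<close> per step on average, and concavity limits its growth beyond \<open>k\<close> to
    \<open>t - 1\<close> per step.\<close>
  with 1 neg have "F k < F s + (k - s) * t" by simp
  from sum_mset_min_concave[OF s(1) this[unfolded F_def], of "c - s"]
  have 2: "F (k + (c - s)) \<le> F k + (c - s) * (t - 1)" by (simp add: F_def)
  have "F s \<le> F k" unfolding F_def using s by (intro sum_mset_mono) auto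
  then have "t \<ge> 1" using \<open>F k < F s + (k - s) * t\<close> by (cases t) auto
  have "g (T - S) \<ge> (c - s) * t"
    unfolding g_def using sum_bounded_below[of "T - S" t m] T(3) cTS by simp
  moreover have "g (S \<union> T) = g S + g (T - S)"
    unfolding g_def using S T by (metis Diff_disjoint Un_Diff_cancel finite_Diff sum.union_disjoint)
  moreover have "card (S \<union> T) = k + (c - s)"
    using card_Un_disjoint[of S "T - S"] S T cTS by (simp add: k_def)
  ultimately have "g S + (c - s) * t \<le> c + F (k + (c - s))" using B[of "S \<union> T"] S T by simp
  \<comment> \<open>With this and \<open>2\<close>, the bound for \<open>S \<union> T\<close>
    becomes \<open>g S \<le> F k + s\<close>, against \<open>neg\<close>. Since subtraction is
    truncated, the identity relies on \<open>t \<ge> 1\<close>.\<close>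
  moreover have "(c - s) * t = (c - s) * (t - 1) + (c - s)" using \<open>t \<ge> 1\<close> by (cases t) auto
  ultimately show False using 2 neg s by linarith
qed

text \<open>Sufficiency in Gale--Ryser, with \<open>f\<close> as a colouring of \<open>X\<close>.
  Blocks are split off greedily: a block of size \<open>c\<close> takes one element from each of the
  \<open>c\<close> most frequent colours, and \<open>remove_top_counts\<close> keeps the hypothesis
  valid for the rest.\<close>

lemma transversal_partition_exists:
  fixes X :: "nat set"
  assumes "finite X" "card X = sum_mset q" "0 \<notin># q"
    and "\<And>S. finite S \<Longrightarrow> card {x \<in> X. f x \<in> S} \<le> (\<Sum>c\<in>#q. min c (card S))"
  shows "\<exists>\<sigma>. partition_on X \<sigma> \<and> shape \<sigma> = q \<and> (\<forall>C\<in>\<sigma>. inj_on f C)"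
  using assms
proof (induction q arbitrary: X)
  case empty
  then show ?case by (auto simp: partition_on_empty intro!: exI[of _ "{}"])
next
  case (add c q)
  define m where "m i = card {x \<in> X. f x = i}" for i
  have count: "card {x \<in> X. f x \<in> S} = (\<Sum>i\<in>S. m i)" if "finite S" for S
  proof -
    have "{x \<in> X. f x \<in> S} = (\<Union>i\<in>S. {x \<in> X. f x = i})" by auto
    then show ?thesis unfolding m_def using that add.prems(1) by (auto intro!: card_UN_disjoint)
  qed
  \<comment> \<open>With fewer than \<open>c\<close> colours, the part \<open>c\<close> would
    contribute less than \<open>c\<close> to the bound for the set of all occurring colours, which
    would then fall below \<open>card X\<close>.\<close>
  have "c \<le> card (f ` X)"
  proof (rule ccontr)
    assume "\<not> ?thesis"
    moreover have "(\<Sum>d\<in>#q. min d (card (f ` X))) \<le> sum_mset q"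
      using sum_mset_mono[of q "\<lambda>d. min d (card (f ` X))" "\<lambda>d. d"] by simp
    moreover have "{x \<in> X. f x \<in> f ` X} = X" by auto
    ultimately show False using add.prems(1,2) add.prems(4)[of "f ` X"] by simp
  qed
  then obtain T where T: "T \<subseteq> f ` X" "card T = c" "\<forall>x\<in>T. \<forall>y\<in>f ` X - T. m y \<le> m x"
    using top_subset_exists[of "f ` X" c m] add.prems(1) by auto
  have "finite T" using T(1) add.prems(1) finite_subset by blast
  have "T \<noteq> {}" using T add.prems(3) by auto
  \<comment> \<open>A threshold between the frequencies of the colours in \<open>T\<close> and of
    all others; colours that do not occur have frequency 0.\<close>
  define t where "t = Min (m ` T)"
  have t1: "t \<le> m i" if "i \<in> T" for i using that \<open>finite T\<close> by (simp add: t_def)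
  have t2: "m i \<le> t" if "i \<notin> T" for i
  proof (cases "i \<in> f ` X")
    case True
    have "t \<in> m ` T" unfolding t_def using \<open>finite T\<close> \<open>T \<noteq> {}\<close> by (intro Min_in) auto
    then show ?thesis using T(3) True that by auto
  next
    case False
    then have "{x \<in> X. f x = i} = {}" by auto
    then show ?thesis unfolding m_def by (metis card.empty le0)
  qed
  \<comment> \<open>One representative of each colour in \<open>T\<close>.\<close>
  define C where "C = inv_into X f ` T"
  have inv: "inv_into X f i \<in> X" "f (inv_into X f i) = i" if "i \<in> T" for i
    using that T(1) by (auto intro: inv_into_into f_inv_into_f)
  have inj: "inj_on f C" unfolding C_def inj_on_def using inv by auto
  have "C \<subseteq> X" unfolding C_def using inv by auto
  have "card C = c"
    unfolding C_def using inv T(2) by (metis card_image inj_onI)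
  have "C \<noteq> {}" "finite C" using \<open>T \<noteq> {}\<close> \<open>finite T\<close> by (auto simp: C_def)
  have "\<exists>\<sigma>. partition_on (X - C) \<sigma> \<and> shape \<sigma> = q \<and> (\<forall>C\<in>\<sigma>. inj_on f C)"
  proof (rule add.IH)
    show "finite (X - C)" "0 \<notin># q" using add.prems by auto
    show "card (X - C) = sum_mset q"
      using \<open>card C = c\<close> \<open>C \<subseteq> X\<close> \<open>finite C\<close> add.prems(2) by (simp add: card_Diff_subset)
    fix S assume S: "finite (S :: 'a set)"
    have "{x \<in> C. f x \<in> S} = inv_into X f ` (S \<inter> T)" unfolding C_def using inv by auto
    moreover have "inj_on (inv_into X f) (S \<inter> T)" using inv by (metis IntD2 inj_onI)
    ultimately have cC: "card {x \<in> C. f x \<in> S} = card (S \<inter> T)" by (simp add: card_image)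
    \<comment> \<open>Removing \<open>C\<close> lowers the count for \<open>S\<close> by exactly
      \<open>card (S \<inter> T)\<close>, the extra term in
      \<open>remove_top_counts\<close>.\<close>
    have "{x \<in> X - C. f x \<in> S} = {x \<in> X. f x \<in> S} - {x \<in> C. f x \<in> S}" by auto
    then have "card {x \<in> X - C. f x \<in> S} = card {x \<in> X. f x \<in> S} - card (S \<inter> T)"
      using cC \<open>finite C\<close> \<open>C \<subseteq> X\<close> by (subst card_Diff_subset[symmetric, of "{x \<in> C. f x \<in> S}", unfolded cC]) auto
    also have "\<dots> \<le> (\<Sum>d\<in>#q. min d (card S))"
      using remove_top_counts[of m c q T t S] add.prems(4) count T(2) t1 t2 S \<open>finite T\<close> by simp
    finally show "card {x \<in> X - C. f x \<in> S} \<le> (\<Sum>d\<in>#q. min d (card S))" .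
  qed
  then obtain \<sigma> where \<sigma>: "partition_on (X - C) \<sigma>" "shape \<sigma> = q" "\<forall>C\<in>\<sigma>. inj_on f C" by blast
  note ins = partition_insert[OF \<sigma>(1) \<open>C \<subseteq> X\<close> \<open>C \<noteq> {}\<close>]
  have "finite \<sigma>" using \<sigma>(1) add.prems(1) finite_elements by blast
  then have "shape (insert C \<sigma>) = add_mset c q"
    using shape_insert ins(2) \<sigma>(2) \<open>card C = c\<close> by simp
  then show ?case using ins(1) \<sigma>(3) inj by blast
qed

text \<open>Necessity in Gale--Ryser: a block \<open>C\<close> on which the colouring is injective
  has at most \<open>min (card C) (card S)\<close> elements with colours in
  \<open>S\<close>.\<close>

lemma transversal_partition_bound:
  fixes X :: "nat set"
  assumes "finite X" "partition_on X \<sigma>" "\<And>C. C \<in> \<sigma> \<Longrightarrow> inj_on f C" "finite S"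
  shows "card {x \<in> X. f x \<in> S} \<le> (\<Sum>c\<in>#shape \<sigma>. min c (card S))"
proof -
  have finC: "finite C" if "C \<in> \<sigma>" for C
    using assms(1,2) that by (metis Sup_upper finite_subset partition_onD1)
  have "{x \<in> X. f x \<in> S} = (\<Union>C\<in>\<sigma>. {x \<in> C. f x \<in> S})"
    using partition_onD1[OF assms(2)] by auto
  then have "card {x \<in> X. f x \<in> S} \<le> (\<Sum>C\<in>\<sigma>. card {x \<in> C. f x \<in> S})"
    using card_UN_le[OF finite_elements[OF assms(1,2)], of "\<lambda>C. {x \<in> C. f x \<in> S}"] by simp
  also have "\<dots> \<le> (\<Sum>C\<in>\<sigma>. min (card C) (card S))"
  proof (rule sum_mono)
    fix C assume C: "C \<in> \<sigma>"
    have "card {x \<in> C. f x \<in> S} \<le> card S"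
      by (rule card_inj_on_le[of f]) (use assms(3)[OF C] assms(4) in \<open>auto simp: inj_on_def\<close>)
    moreover have "card {x \<in> C. f x \<in> S} \<le> card C" using finC[OF C] by (intro card_mono) auto
    ultimately show "card {x \<in> C. f x \<in> S} \<le> min (card C) (card S)" by simp
  qed
  also have "\<dots> = (\<Sum>c\<in>#shape \<sigma>. min c (card S))"
    by (simp add: shape_def sum_unfold_sum_mset multiset.map_comp comp_def)
  finally show ?thesis .
qed

section \<open>Dominance\<close>

lemma mset_parts_desc [simp]: "mset (parts_desc p) = p"
  by (simp add: parts_desc_def)

lemma sorted_parts_desc: "sorted_wrt (\<ge>) (parts_desc p)"
  using sorted_sorted_list_of_multiset[of p] by (simp add: parts_desc_def sorted_wrt_rev)

lemma parts_desc_mset: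
  assumes "sorted_wrt (\<ge>) xs"
  shows "parts_desc (mset xs) = xs"
proof -
  have "sort xs = rev xs" by (rule properties_for_sort) (use assms in \<open>auto simp: sorted_wrt_rev\<close>)
  then show ?thesis by (simp add: parts_desc_def)
qed

text \<open>Induction along the list, comparing the head \<open>x\<close> with an element
  \<open>y\<close> of \<open>q\<close>. Taking \<open>y = x\<close> whenever \<open>x\<close> occurs
  in \<open>q\<close> leaves a remainder that fits into the tail.\<close>

lemma sum_mset_le_sum_take:
  fixes xs :: "nat list"
  assumes "sorted_wrt (\<ge>) xs" "q \<subseteq># mset xs"
  shows "sum_mset q \<le> sum_list (take (size q) xs)"
  using assms
proof (induction xs arbitrary: q)
  case (Cons x xs)
  show ?case
  proof (cases "q = {#}")
    case False
    obtain y r where y: "q = add_mset y r" "r \<subseteq># mset xs"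
    proof (cases "x \<in># q")
      case True
      then obtain r where "q = add_mset x r" by (metis insert_DiffM)
      then show ?thesis using that Cons.prems by simp
    next
      case x: False
      then have "q \<subseteq># mset xs" using Cons.prems(2)
        by (metis add_mset_add_single diff_single_trivial mset.simps(2) subset_eq_diff_conv)
      moreover obtain y where "y \<in># q" using False by blast
      ultimately show ?thesis using that[of y "q - {#y#}"]
        by (metis diff_subset_eq_self insert_DiffM subset_mset.trans)
    qed
    have "y \<in># mset (x # xs)" using y Cons.prems(2) by (metis mset_subset_eqD union_single_eq_member)
    then have "y \<le> x" using Cons.prems(1) by auto
    with Cons.IH[of r] Cons.prems(1) y show ?thesis by auto
  qed simp
qed simp

text \<open>\<open>S\<close> consists of the first \<open>k\<close> blocks in order of decreasing
  size; it is smaller than \<open>k\<close> when there are fewer blocks.\<close>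

lemma sum_take_parts_desc_shape:
  assumes "finite \<pi>"
  shows "\<exists>S\<subseteq>\<pi>. card S \<le> k \<and> sum_list (take k (parts_desc (shape \<pi>))) = (\<Sum>B\<in>S. card B)"
proof -
  obtain ys where ys: "set ys = \<pi>" "distinct ys" using finite_distinct_list[OF assms] by blast
  define xs where "xs = rev (sort_key card ys)"
  have xs: "set xs = \<pi>" "distinct xs" by (auto simp: xs_def ys)
  have "sorted_wrt (\<ge>) (map card xs)"
    using sorted_sort_key[of card ys] by (simp add: xs_def rev_map[symmetric] sorted_wrt_rev)
  moreover have "mset (map card xs) = shape \<pi>"
    using xs by (metis mset_map mset_set_set shape_def)
  ultimately have "parts_desc (shape \<pi>) = map card xs" by (metis parts_desc_mset)
  moreover have "sum_list (map card (take k xs)) = (\<Sum>B\<in>set (take k xs). card B)"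
    using xs(2) by (simp add: sum_list_distinct_conv_sum_set)
  moreover have "card (set (take k xs)) \<le> k" using card_length[of "take k xs"] by simp
  ultimately show ?thesis using xs(1) set_take_subset[of k xs]
    by (intro exI[of _ "set (take k xs)"]) (simp add: take_map)
qed

text \<open>Both sides count the cells in the first \<open>k\<close> columns of the Ferrers diagram
  of \<open>q\<close>, by columns on the left and by rows on the right.\<close>

lemma sum_take_parts_desc_transpose:
  "sum_list (take k (parts_desc (transpose_part q))) = (\<Sum>c\<in>#q. min c k)"
proof -
  \<comment> \<open>The inserted 0 keeps \<open>Max\<close> meaningful for empty
    \<open>q\<close>.\<close>
  define M where "M = Max (insert 0 (set_mset q))"
  define d where "d j = size {#x \<in># q. j \<le> x#}" for j
  have M: "x \<le> M" if "x \<in># q" for x using that by (simp add: M_def)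
  have "M \<in> insert 0 (set_mset q)" unfolding M_def by (intro Max_in) auto
  then have set: "{j. 1 \<le> j \<and> (\<exists>x\<in>#q. j \<le> x)} = set [1..<Suc M]"
    using M by fastforce
  have "transpose_part q = mset (map d [1..<Suc M])"
    unfolding transpose_part_def set d_def[symmetric] mset_set_set[OF distinct_upt] by simp
  moreover have "d j \<le> d i" if "i \<le> j" for i j
    unfolding d_def using that by (intro size_filter_ge_antimono) simp
  then have "sorted_wrt (\<ge>) (map d [1..<Suc M])"
    unfolding sorted_wrt_map by (intro sorted_wrt_mono_rel[OF _ sorted_upt]) auto
  ultimately have pd: "parts_desc (transpose_part q) = map d [1..<Suc M]"
    using parts_desc_mset by metis
  have sum: "sum_list (map d [1..<Suc l]) = (\<Sum>c\<in>#q. min c l)" for l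
  proof (induction l)
    case (Suc l)
    then show ?case using sum_mset_min_Suc[of l q] by (simp add: d_def)
  qed simp
  \<comment> \<open>Past \<open>M\<close> the list is exhausted; as no part exceeds
    \<open>M\<close>, replacing \<open>k\<close> by \<open>min k M\<close> changes no
    summand.\<close>
  have "take k [1..<Suc M] = [1..<Suc (min k M)]"
    by (cases "k \<le> M") (simp_all add: min_def del: upt_Suc)
  then have "sum_list (take k (parts_desc (transpose_part q))) = (\<Sum>c\<in>#q. min c (min k M))"
    by (simp only: pd take_map sum)
  also have "image_mset (\<lambda>c. min c (min k M)) q = image_mset (\<lambda>c. min c k) q"
    by (rule image_mset_cong) (use M in \<open>fastforce simp: min_def\<close>)
  finally show ?thesis .
qed

text \<open>The \<open>k\<close> largest blocks have the largest total size among \<open>k\<close>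
  blocks, so comparing partial sums amounts to a bound for every set of blocks. This is the form of
  the colour bound in the previous section.\<close>

lemma dom_le_transpose_iff:
  assumes "finite \<pi>"
  shows "dom_le (shape \<pi>) (transpose_part q) \<longleftrightarrow>
    (\<forall>S\<subseteq>\<pi>. (\<Sum>B\<in>S. card B) \<le> (\<Sum>c\<in>#q. min c (card S)))"
proof
  assume dom: "dom_le (shape \<pi>) (transpose_part q)"
  show "\<forall>S\<subseteq>\<pi>. (\<Sum>B\<in>S. card B) \<le> (\<Sum>c\<in>#q. min c (card S))"
  proof (intro allI impI)
    fix S assume "S \<subseteq> \<pi>"
    then have "shape S \<subseteq># mset (parts_desc (shape \<pi>))"
      using assms by (simp add: shape_def image_mset_subseteq_mono subset_imp_msubset_mset_set)
    from sum_mset_le_sum_take[OF sorted_parts_desc this]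
    have "(\<Sum>B\<in>S. card B) \<le> sum_list (take (card S) (parts_desc (shape \<pi>)))"
      by (simp add: sum_mset_shape size_shape)
    also have "\<dots> \<le> (\<Sum>c\<in>#q. min c (card S))"
      using dom sum_take_parts_desc_transpose unfolding dom_le_def by metis
    finally show "(\<Sum>B\<in>S. card B) \<le> (\<Sum>c\<in>#q. min c (card S))" .
  qed
next
  assume R: "\<forall>S\<subseteq>\<pi>. (\<Sum>B\<in>S. card B) \<le> (\<Sum>c\<in>#q. min c (card S))"
  show "dom_le (shape \<pi>) (transpose_part q)"
    unfolding dom_le_def sum_take_parts_desc_transpose
  proof
    fix k
    obtain S where S: "S \<subseteq> \<pi>" "card S \<le> k"
      "sum_list (take k (parts_desc (shape \<pi>))) = (\<Sum>B\<in>S. card B)"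
      using sum_take_parts_desc_shape[OF assms] by blast
    have "(\<Sum>B\<in>S. card B) \<le> (\<Sum>c\<in>#q. min c (card S))" using R S(1) by blast
    also have "\<dots> \<le> (\<Sum>c\<in>#q. min c k)" using S(2) by (intro sum_mset_mono) auto
    finally show "sum_list (take k (parts_desc (shape \<pi>))) \<le> (\<Sum>c\<in>#q. min c k)" using S(3) by simp
  qed
qed

section \<open>Gale--Ryser for set partitions\<close>

text \<open>The negation says that every block of \<pi> meets every block of \<sigma> in at most one
  point, so that the intersection sizes form a 0-1 matrix.\<close>

definition share_pair :: "'a set set \<Rightarrow> 'a set set \<Rightarrow> bool" where
  "share_pair \<pi> \<sigma> \<longleftrightarrow> (\<exists>B\<in>\<pi>. \<exists>C\<in>\<sigma>. \<exists>x\<in>B \<inter> C. \<exists>y\<in>B \<inter> C. x \<noteq> y)"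

text \<open>The Gale--Ryser theorem, for the 0-1 matrices \<open>(card (B \<inter> C))\<close> indexed by \<open>B \<in> \<pi>\<close>, \<open>C \<in> \<sigma>\<close>.\<close>

lemma disjoint_pairs_iff_dom_le:
  assumes "finite X" "partition_on X \<pi>" "0 \<notin># q" "sum_mset q = card X"
  shows "(\<exists>\<sigma>. partition_on X \<sigma> \<and> shape \<sigma> = q \<and> \<not> share_pair \<pi> \<sigma>) \<longleftrightarrow>
    dom_le (shape \<pi>) (transpose_part q)"
proof -
  have fin: "finite \<pi>" using assms finite_elements by blast
  \<comment> \<open>The colour of a point is its block in \<pi>; \<sigma> shares no pair with \<pi>
    iff this colouring is injective on every block of \<sigma>.\<close>
  obtain f where f: "\<And>x. x \<in> X \<Longrightarrow> f x \<in> \<pi> \<and> x \<in> f x"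
  proof -
    have "\<forall>x\<in>X. \<exists>B\<in>\<pi>. x \<in> B" using partition_onD1[OF assms(2)] by blast
    then show ?thesis using that by metis
  qed
  have f_eq: "f x = B" if "B \<in> \<pi>" "x \<in> B" for x B
  proof (rule ccontr)
    assume ne: "f x \<noteq> B"
    have x: "f x \<in> \<pi>" "x \<in> f x" using f that partition_onD1[OF assms(2)] by auto
    have "f x \<inter> B = {}" using disjointD[OF partition_onD2[OF assms(2)] x(1) that(1) ne] .
    with x that show False by blast
  qed
  have inj: "\<not> share_pair \<pi> \<sigma> \<longleftrightarrow> (\<forall>C\<in>\<sigma>. inj_on f C)" if "partition_on X \<sigma>" for \<sigma>
  proof -
    have X: "x \<in> X" if "x \<in> C" "C \<in> \<sigma>" for x C
      using that partition_onD1[OF \<open>partition_on X \<sigma>\<close>] by blast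
    have same: "(\<exists>B\<in>\<pi>. x \<in> B \<and> y \<in> B) \<longleftrightarrow> f x = f y" if "x \<in> X" "y \<in> X" for x y
    proof
      assume "\<exists>B\<in>\<pi>. x \<in> B \<and> y \<in> B"
      then show "f x = f y" using f_eq by auto
    next
      assume "f x = f y"
      then show "\<exists>B\<in>\<pi>. x \<in> B \<and> y \<in> B" using f[OF that(1)] f[OF that(2)] by auto
    qed
    have "share_pair \<pi> \<sigma> \<longleftrightarrow> (\<exists>C\<in>\<sigma>. \<exists>x\<in>C. \<exists>y\<in>C. x \<noteq> y \<and> (\<exists>B\<in>\<pi>. x \<in> B \<and> y \<in> B))"
      unfolding share_pair_def by blast
    also have "\<dots> \<longleftrightarrow> (\<exists>C\<in>\<sigma>. \<exists>x\<in>C. \<exists>y\<in>C. x \<noteq> y \<and> f x = f y)"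
      using same X by (intro bex_cong refl conj_cong) auto
    finally show ?thesis unfolding inj_on_def by blast
  qed
  have count: "card {x \<in> X. f x \<in> S} = (\<Sum>B\<in>S \<inter> \<pi>. card B)" for S
  proof -
    have "{x \<in> X. f x \<in> S} = \<Union>(S \<inter> \<pi>)"
      using f f_eq partition_onD1[OF assms(2)] by blast
    moreover have "pairwise disjnt (S \<inter> \<pi>)" using partition_onD2[OF assms(2)] by (rule pairwise_subset) simp
    moreover have "finite B" if "B \<in> S \<inter> \<pi>" for B
      using that assms(1) partition_onD1[OF assms(2)] by (metis IntD2 Sup_upper finite_subset)
    ultimately show ?thesis by (metis card_Union_disjoint)
  qed
  show ?thesis unfolding dom_le_transpose_iff[OF fin]
  proof
    assume "\<exists>\<sigma>. partition_on X \<sigma> \<and> shape \<sigma> = q \<and> \<not> share_pair \<pi> \<sigma>"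
    then obtain \<sigma> where \<sigma>: "partition_on X \<sigma>" "shape \<sigma> = q" "\<forall>C\<in>\<sigma>. inj_on f C" using inj by blast
    show "\<forall>S\<subseteq>\<pi>. (\<Sum>B\<in>S. card B) \<le> (\<Sum>c\<in>#q. min c (card S))"
    proof (intro allI impI)
      fix S assume "S \<subseteq> \<pi>"
      then show "(\<Sum>B\<in>S. card B) \<le> (\<Sum>c\<in>#q. min c (card S))"
        using transversal_partition_bound[OF assms(1) \<sigma>(1), of f S] \<sigma> count[of S] finite_subset[OF _ fin]
        by (simp add: Int_absorb2)
    qed
  next
    assume R: "\<forall>S\<subseteq>\<pi>. (\<Sum>B\<in>S. card B) \<le> (\<Sum>c\<in>#q. min c (card S))"
    have "card {x \<in> X. f x \<in> S} \<le> (\<Sum>c\<in>#q. min c (card S))" if "finite S" for S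
    proof -
      \<comment> \<open>Only blocks of \<pi> occur as colours, so \<open>S\<close> may be cut down
        to \<open>S \<inter> \<pi>\<close>.\<close>
      have "card {x \<in> X. f x \<in> S} \<le> (\<Sum>c\<in>#q. min c (card (S \<inter> \<pi>)))" using R count by simp
      also have "\<dots> \<le> (\<Sum>c\<in>#q. min c (card S))"
        using card_mono[OF that, of "S \<inter> \<pi>"] by (intro sum_mset_mono) auto
      finally show ?thesis .
    qed
    then show "\<exists>\<sigma>. partition_on X \<sigma> \<and> shape \<sigma> = q \<and> \<not> share_pair \<pi> \<sigma>"
      using transversal_partition_exists[of X q f] assms inj by metis
  qed
qed

section \<open>Blockers in the partition lattice\<close>

lemma is_bottom_set_parts_iff:
  assumes "\<pi> \<in> set_parts n"
  shows "is_bottom (set_parts n) (refines {1..n}) \<pi> \<longleftrightarrow> (\<forall>B\<in>\<pi>. \<forall>x\<in>B. \<forall>y\<in>B. x = y)"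
proof
  let ?b = "(\<lambda>x. {x}) ` {1..n}"
  assume "is_bottom (set_parts n) (refines {1..n}) \<pi>"
  then have "refines {1..n} \<pi> ?b"
    using partition_on_singletons by (auto simp: is_bottom_def set_parts_def)
  then show "\<forall>B\<in>\<pi>. \<forall>x\<in>B. \<forall>y\<in>B. x = y" unfolding refines_def by blast
next
  assume R: "\<forall>B\<in>\<pi>. \<forall>x\<in>B. \<forall>y\<in>B. x = y"
  have p: "partition_on {1..n} \<pi>" using assms by (simp add: set_parts_def)
  have "refines {1..n} \<pi> \<rho>" if \<rho>: "partition_on {1..n} \<rho>" for \<rho>
  proof -
    have "\<exists>Y\<in>\<rho>. B \<subseteq> Y" if B: "B \<in> \<pi>" for B
    proof -
      obtain x where "x \<in> B" using p B by (metis all_not_in_conv partition_onD3)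
      moreover from this have "x \<in> \<Union>\<rho>"
        using B partition_onD1[OF p] partition_onD1[OF \<rho>] by blast
      then obtain Y where "Y \<in> \<rho>" "x \<in> Y" by (rule UnionE)
      moreover have "B \<subseteq> {x}" using R[rule_format, OF B _ \<open>x \<in> B\<close>] by blast
      ultimately show ?thesis by blast
    qed
    with p \<rho> show ?thesis by (simp add: refines_def)
  qed
  with assms show "is_bottom (set_parts n) (refines {1..n}) \<pi>"
    by (simp add: is_bottom_def set_parts_def)
qed

lemma pair_partition:
  assumes "x \<in> X" "y \<in> X" "x \<noteq> y"
  shows "partition_on X (insert {x, y} ((\<lambda>z. {z}) ` (X - {x, y})))"
  using assms partition_on_singletons[of "X - {x, y}"] by (intro partition_insert) auto

lemma refines_pair_partition:
  assumes "partition_on X \<pi>" "B \<in> \<pi>" "x \<in> B" "y \<in> B" "x \<noteq> y"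
  shows "refines X (insert {x, y} ((\<lambda>z. {z}) ` (X - {x, y}))) \<pi>"
proof -
  have "x \<in> X" "y \<in> X" using assms partition_onD1 by blast+
  then show ?thesis using pair_partition[of x X y] assms partition_onD1[OF assms(1)]
    by (auto simp: refines_def)
qed

text \<open>A refinement other than the bottom has a block with two points. That block lies in
  \<open>{x, y}\<close>, so it contains both \<open>x\<close> and \<open>y\<close>, and antisymmetry
  applies.\<close>

lemma pair_partition_is_atom:
  assumes "x \<in> {1..n}" "y \<in> {1..n}" "x \<noteq> y"
  shows "is_atom (set_parts n) (refines {1..n}) (insert {x, y} ((\<lambda>z. {z}) ` ({1..n} - {x, y})))"
    (is "is_atom _ _ ?a")
proof -
  have a: "?a \<in> set_parts n" using pair_partition[OF assms] by (simp add: set_parts_def)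
  moreover have "\<not> is_bottom (set_parts n) (refines {1..n}) ?a"
    unfolding is_bottom_set_parts_iff[OF a] using assms(3) by simp
  moreover have "\<rho> = ?a \<or> is_bottom (set_parts n) (refines {1..n}) \<rho>"
    if \<rho>: "\<rho> \<in> set_parts n" "refines {1..n} \<rho> ?a" for \<rho>
  proof (cases "is_bottom (set_parts n) (refines {1..n}) \<rho>")
    case False
    then obtain B u v where B: "B \<in> \<rho>" "u \<in> B" "v \<in> B" "u \<noteq> v"
      unfolding is_bottom_set_parts_iff[OF \<rho>(1)] by blast
    obtain Y where "Y \<in> ?a" "B \<subseteq> Y" using \<rho>(2) B(1) unfolding refines_def by meson
    with B have "Y = {x, y}" by auto
    then have "x \<in> B" "y \<in> B" using B \<open>B \<subseteq> Y\<close> by auto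
    then have "refines {1..n} ?a \<rho>"
      using refines_pair_partition[OF _ B(1)] \<rho>(1) assms(3) by (simp add: set_parts_def)
    with \<rho>(2) show ?thesis using refines_asym by blast
  qed simp
  ultimately show ?thesis unfolding is_atom_def by blast
qed

text \<open>An atom is not the bottom, so it has a block with two points, and these stay together in
  everything above it. Conversely, a shared pair yields the atom that joins just these two
  points.\<close>

lemma atoms_below_meet_iff:
  assumes "\<pi> \<in> set_parts n" "\<sigma> \<in> set_parts n"
  shows "atoms_below (set_parts n) (refines {1..n}) \<pi> \<inter> atoms_below (set_parts n) (refines {1..n}) \<sigma> \<noteq> {}
    \<longleftrightarrow> share_pair \<pi> \<sigma>"
proof
  assume "atoms_below (set_parts n) (refines {1..n}) \<pi> \<inter> atoms_below (set_parts n) (refines {1..n}) \<sigma> \<noteq> {}"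
  then obtain a where a: "is_atom (set_parts n) (refines {1..n}) a" "refines {1..n} a \<pi>" "refines {1..n} a \<sigma>"
    by (auto simp: atoms_below_def)
  then obtain E x y where E: "E \<in> a" "x \<in> E" "y \<in> E" "x \<noteq> y"
    using is_bottom_set_parts_iff[of a n] unfolding is_atom_def by auto
  obtain B C where "B \<in> \<pi>" "E \<subseteq> B" "C \<in> \<sigma>" "E \<subseteq> C"
    using a(2,3) E(1) unfolding refines_def by metis
  moreover from this have "x \<in> B \<inter> C" "y \<in> B \<inter> C" using E by auto
  ultimately show "share_pair \<pi> \<sigma>" unfolding share_pair_def using E(4) by metis
next
  assume "share_pair \<pi> \<sigma>"
  then obtain B C x y where B: "B \<in> \<pi>" "C \<in> \<sigma>" "x \<in> B" "x \<in> C" "y \<in> B" "y \<in> C" "x \<noteq> y"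
    unfolding share_pair_def by auto
  have p: "partition_on {1..n} \<pi>" "partition_on {1..n} \<sigma>" using assms by (auto simp: set_parts_def)
  have xy: "x \<in> {1..n}" "y \<in> {1..n}" using B p(1) partition_onD1 by blast+
  show "atoms_below (set_parts n) (refines {1..n}) \<pi> \<inter> atoms_below (set_parts n) (refines {1..n}) \<sigma> \<noteq> {}"
    using pair_partition_is_atom[OF xy B(7)] refines_pair_partition[OF p(1) B(1,3,5,7)]
      refines_pair_partition[OF p(2) B(2,4,6,7)]
    unfolding atoms_below_def by blast
qed

theorem theorem3p1:
  fixes n :: nat and A :: "nat multiset set"
  assumes "antichain (int_parts n) ref_le A"
  shows "blocker (set_parts n) (refines {1..n}) (fiber n A) =
    fiber n (minimal_elems ref_le
      (int_parts n - (\<Union>p\<in>A. down_set (int_parts n) dom_le (transpose_part p))))"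
proof -
  let ?U = "int_parts n - (\<Union>p\<in>A. down_set (int_parts n) dom_le (transpose_part p))"
  have A: "A \<subseteq> int_parts n" using assms unfolding antichain_def by (rule conjunct1)
  have "(\<forall>\<sigma>\<in>fiber n A. atoms_below (set_parts n) (refines {1..n}) \<pi> \<inter>
      atoms_below (set_parts n) (refines {1..n}) \<sigma> \<noteq> {}) \<longleftrightarrow> shape \<pi> \<in> ?U"
    if \<pi>: "\<pi> \<in> set_parts n" for \<pi>
  proof -
    \<comment> \<open>Negated over all \<open>p \<in> A\<close>, this says that \<pi> shares a pair
      with every member of the fiber iff no transpose dominates its shape.\<close>
    have gr: "(\<exists>\<sigma>\<in>set_parts n. shape \<sigma> = p \<and> \<not> share_pair \<pi> \<sigma>) \<longleftrightarrow> dom_le (shape \<pi>) (transpose_part p)"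
      if "p \<in> A" for p
      using disjoint_pairs_iff_dom_le[of "{1..n}" \<pi> p] \<pi> that A
      by (auto simp: set_parts_def int_parts_def)
    have "(\<forall>\<sigma>\<in>fiber n A. atoms_below (set_parts n) (refines {1..n}) \<pi> \<inter>
        atoms_below (set_parts n) (refines {1..n}) \<sigma> \<noteq> {}) \<longleftrightarrow> (\<forall>\<sigma>\<in>fiber n A. share_pair \<pi> \<sigma>)"
      using atoms_below_meet_iff[OF \<pi>] by (auto simp: fiber_def)
    also have "\<dots> \<longleftrightarrow> (\<forall>p\<in>A. \<not> dom_le (shape \<pi>) (transpose_part p))"
      using gr by (auto simp: fiber_def)
    also have "\<dots> \<longleftrightarrow> shape \<pi> \<in> ?U"
      using shape_in_int_parts[OF \<pi>] by (auto simp: down_set_def)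
    finally show ?thesis .
  qed
  then have "blocker (set_parts n) (refines {1..n}) (fiber n A) = minimal_elems (refines {1..n}) (fiber n ?U)"
    unfolding blocker_def fiber_def[of n ?U] by (metis (no_types, lifting))
  also have "\<dots> = fiber n (minimal_elems ref_le ?U)" by (rule minimal_elems_fiber) blast
  finally show ?thesis .
qed

end
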